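(* Let $m\ge1$ and let $k_1,\ldots,k_m$, $n_1,\ldots,n_m$ be integers with $n_i \geq k_i > 0$ for all $i \in [m]$. Let $M$ be the complement of a $(k_1, \ldots, k_m; n_1, \ldots, n_m)$ circulant block diagonal matrix. Suppose that for each $i \in [m]$, $k_i$ divides $n_i$, and that some $i \in [m]$ satisfies $n_i > k_i >1$. Then \[\mathrm{rank}_{\mathrm{bin}}(M) \geq \mathrm{rank}_{\mathbb{R}}(M) + 1.\]
   Context: For integers $n \ge k \ge 0$, $D_{n,k}$ denotes the $n\times n$ circulant $0,1$ matrix whose first row consists of $n-k$ ones followed by $k$ zeros, each subsequent row being the cyclic shift of the previous row by one position to the right. For integers $n_i \ge k_i \ge 0$ ($i\in[m]$), a matrix is called $(k_1,\ldots,k_m;n_1,\ldots,n_m)$ circulant block diagonal if it is a block matrix with $m$ diagonal blocks whose $i$th diagonal block is $D_{n_i,n_i-k_i}$ and all of whose other entries are zero. The complement of a $0,1$ matrix is obtained by swapping zeros and ones. The binary rank $\mathrm{rank}_{\mathrm{bin}}(A)$ of a $0,1$ matrix $A$ is the smallest number of combinatorial rectangles (all-one submatrices indexed by a set of rows times a set of columns) that partition the ones of $A$ (equivalently, the smallest inner dimension of a factorization $A=A_1A_2$ over the reals with $0,1$ factors). $\mathrm{rank}_{\mathbb{R}}$ denotes the rank over the reals. *)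

theory Defs
  imports "Jordan_Normal_Form.DL_Rank" "HOL-Library.Disjoint_Sets"
begin

text \<open>Row \<open>i\<close> is \<open>v\<close> cyclically shifted \<open>i\<close> positions to the right; \<open>j + dim_vec v - i\<close> avoids
  truncated subtraction.\<close>

definition circulant_mat :: "'a vec \<Rightarrow> 'a mat" where
  "circulant_mat v = mat (dim_vec v) (dim_vec v) (\<lambda>(i, j). v $ ((j + dim_vec v - i) mod dim_vec v))"

definition D_mat :: "nat \<Rightarrow> nat \<Rightarrow> real mat" where
  "D_mat n k = circulant_mat (vec n (\<lambda>j. if j < n - k then 1 else 0))"

definition circulant_block_diag :: "nat \<Rightarrow> (nat \<Rightarrow> nat) \<Rightarrow> (nat \<Rightarrow> nat) \<Rightarrow> real mat" where
  "circulant_block_diag m k n = diag_block_mat (map (\<lambda>i. D_mat (n i) (n i - k i)) [1..<m + 1])"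

definition complement_mat :: "real mat \<Rightarrow> real mat" where
  "complement_mat A = map_mat (\<lambda>x. 1 - x) A"

definition ones :: "real mat \<Rightarrow> (nat \<times> nat) set" where
  "ones A = {(i, j). i < dim_row A \<and> j < dim_col A \<and> A $$ (i, j) = 1}"

definition rectangle_partition :: "real mat \<Rightarrow> (nat \<times> nat) set set \<Rightarrow> bool" where
  "rectangle_partition A P \<longleftrightarrow> partition_on (ones A) P \<and> (\<forall>R\<in>P. \<exists>I J. R = I \<times> J)"

definition rank_bin :: "real mat \<Rightarrow> nat" where
  "rank_bin A = (LEAST r. \<exists>P. finite P \<and> rectangle_partition A P \<and> card P = r)"

abbreviation rank_real :: "real mat \<Rightarrow> nat" where
  "rank_real A \<equiv> vec_space.rank (dim_row A) A"

text \<open>The \<open>LEAST\<close> above is attained: the singletons partition the ones of any matrix.\<close>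

lemma rank_bin_attained:
  "\<exists>P. finite P \<and> rectangle_partition A P \<and> card P = rank_bin A"
proof -
  let ?S = "(\<lambda>p. {p}) ` ones A"
  have "ones A \<subseteq> {..<dim_row A} \<times> {..<dim_col A}"
    by (auto simp: ones_def)
  then have "finite (ones A)"
    by (rule finite_subset) simp
  moreover have "partition_on (ones A) ?S"
    by (rule partition_onI) (auto simp: disjnt_def)
  moreover have "\<exists>I J. R = I \<times> J" if "R \<in> ?S" for R
  proof -
    from that obtain a b where "R = {(a, b)}" by auto
    then have "R = {a} \<times> {b}" by simp
    then show ?thesis by blast
  qed
  ultimately have "\<exists>P. finite P \<and> rectangle_partition A P \<and> card P = card ?S"
    unfolding rectangle_partition_def by (intro exI[of _ ?S]) simp
  then have "\<exists>r P. finite P \<and> rectangle_partition A P \<and> card P = r"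
    by blast
  then show ?thesis
    unfolding rank_bin_def by (rule LeastI_ex)
qed

end

theory Submission
  imports Defs
begin

text \<open>
  Write \<open>M = J - N\<close> with \<open>N\<close> circulant block diagonal, and let \<open>u\<close> be the vector that equals
  \<open>1 / k\<^sub>i\<close> on the \<open>i\<close>th block. Then \<open>N u = 1\<close> and \<open>N\<^sup>T u = 1\<close>; put \<open>s = \<Sum> u = \<Sum> n\<^sub>i / k\<^sub>i\<close>.
  If the ones of \<open>M\<close> were partitioned into \<open>q \<le> rank M\<close> rectangles with indicator vectors
  \<open>a\<^sub>j, b\<^sub>j\<close>, then \<open>M = A B\<close> would be a full-rank factorization, so every \<open>a\<^sub>j\<close> lies in the column
  space of \<open>M\<close>, which is that of \<open>N\<close>. As \<open>k\<^sub>i\<close> divides \<open>n\<^sub>i\<close>, even \<open>a\<^sub>j = N y\<close> with \<open>y\<close> integral. The vector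
  \<open>z = (u \<bullet> a\<^sub>j) / (s - 1) u - y\<close> satisfies \<open>M z = a\<^sub>j\<close>, hence \<open>b\<^sub>j \<bullet> z = 1\<close>, that is,
  \<open>(u \<bullet> a\<^sub>j) (u \<bullet> b\<^sub>j) = (s - 1) (1 + b\<^sub>j \<bullet> y)\<close>. The left side is positive and \<open>b\<^sub>j \<bullet> y\<close> is an integer, so
  the left side is at least \<open>s - 1\<close>. Summing over \<open>j\<close> gives \<open>q (s - 1) \<le> u \<bullet> M u = s (s - 1)\<close>, so
  \<open>q \<le> s\<close>. But \<open>N\<close>, and hence \<open>M\<close>, has more than \<open>s\<close> independent columns: those whose windows tile
  the blocks, and one more from a block with \<open>n\<^sub>i > k\<^sub>i > 1\<close>.
\<close>

abbreviation ones_vec :: "nat \<Rightarrow> real vec" where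
  "ones_vec d \<equiv> vec d (\<lambda>_. 1)"

text \<open>The weight \<open>u\<close> recovers coordinate sums from images:
  \<open>ones_vec d \<bullet> x\<close> equals \<open>u \<bullet> (N *\<^sub>v x)\<close>.
  Positivity makes \<open>u\<close> pair positively with every nonzero 0/1 vector.\<close>

definition balancing :: "nat \<Rightarrow> real mat \<Rightarrow> real vec \<Rightarrow> bool" where
  "balancing d N u \<longleftrightarrow> u \<in> carrier_vec d \<and> (\<forall>i<d. 0 < u $ i) \<and>
     N *\<^sub>v u = ones_vec d \<and> transpose_mat N *\<^sub>v u = ones_vec d"

text \<open>For integral \<open>N\<close> this is saturation of a lattice: the integer span of the
  columns contains all integer points of their real span.\<close>

definition saturated :: "nat \<Rightarrow> real mat \<Rightarrow> bool" where
  "saturated d N \<longleftrightarrow> (\<forall>x\<in>carrier_vec d. (\<forall>i<d. (N *\<^sub>v x) $ i \<in> \<int>) \<longrightarrow>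
     (\<exists>y\<in>carrier_vec d. (\<forall>i<d. y $ i \<in> \<int>) \<and> N *\<^sub>v y = N *\<^sub>v x))"

text \<open>Working with indices instead of a set of columns makes repeated columns count as
  dependent and lets block sums simply shift \<open>C\<close>.\<close>

definition indep_cols :: "nat \<Rightarrow> real mat \<Rightarrow> nat set \<Rightarrow> bool" where
  "indep_cols d N C \<longleftrightarrow> C \<subseteq> {..<d} \<and>
     (\<forall>x\<in>carrier_vec d. (\<forall>i<d. i \<notin> C \<longrightarrow> x $ i = 0) \<longrightarrow> N *\<^sub>v x = 0\<^sub>v d \<longrightarrow> x = 0\<^sub>v d)"

definition binary_mat :: "real mat \<Rightarrow> bool" where
  "binary_mat N \<longleftrightarrow> (\<forall>i<dim_row N. \<forall>j<dim_col N. N $$ (i, j) = 0 \<or> N $$ (i, j) = 1)"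

section \<open>Factorizations\<close>

text \<open>Choose \<open>q\<close> independent columns of \<open>A * B\<close>. The selected part
  is \<open>A * T\<close> with \<open>T\<close> square and the product injective, so
  \<open>T\<close> is invertible. As \<open>T\<close> is \<open>B\<close> times a selection matrix,
  \<open>B\<close> has a right inverse, and \<open>A\<close> is injective.\<close>

lemma full_rank_factorization:
  fixes A B :: "real mat"
  assumes A: "A \<in> carrier_mat d q" and B: "B \<in> carrier_mat q c"
    and rank: "q \<le> vec_space.rank d (A * B)"
  obtains X where "X \<in> carrier_mat c q" "B * X = 1\<^sub>m q"
    and "\<And>v. v \<in> carrier_vec q \<Longrightarrow> A *\<^sub>v v = 0\<^sub>v d \<Longrightarrow> v = 0\<^sub>v q"
proof -
  interpret vec_space "TYPE(real)" d .
  define M where "M = A * B"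
  have M: "M \<in> carrier_mat d c" using A B by (simp add: M_def)
  obtain U where U: "maximal U (\<lambda>T. T \<subseteq> set (cols M) \<and> lin_indpt T)"
    using maximal_exists_superset[of "set (cols M)" "\<lambda>T. T \<subseteq> set (cols M) \<and> lin_indpt T" "{}"]
    by (auto simp: lin_dep_def)
  have "q \<le> card U"
    using rank rank_card_indpt[OF M U] by (simp add: M_def)
  then obtain V where V: "V \<subseteq> U" "card V = q" "finite V"
    by (rule obtain_subset_with_card_n)
  have Vc: "V \<subseteq> set (cols M)" and ind: "lin_indpt V"
    using U V(1) subset_li_is_li unfolding maximal_def by blast+
  have Vd: "V \<subseteq> carrier_vec d" using Vc cols_dim[of M] M by auto
  obtain us where us: "set us = V" "distinct us"
    using finite_distinct_list[OF V(3)] by blast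
  have len: "length us = q" using us V(2) distinct_card by fastforce
  define MV where "MV = mat_of_cols d us"
  have MV: "MV \<in> carrier_mat d q" by (simp add: MV_def len carrier_matI)
  have colsMV: "cols MV = us" using us Vd by (simp add: MV_def)
  have inj: "v = 0\<^sub>v q" if "v \<in> carrier_vec q" "MV *\<^sub>v v = 0\<^sub>v d" for v
    using lin_depI[OF MV that(1) _ that(2)] ind colsMV us by auto
  have "\<exists>i<c. us ! j = col M i" if "j < q" for j
  proof -
    have "us ! j \<in> set (cols M)" using that len us Vc by (metis nth_mem subsetD)
    then show ?thesis using M unfolding in_set_conv_nth by fastforce
  qed
  then obtain f where f: "\<And>j. j < q \<Longrightarrow> f j < c" "\<And>j. j < q \<Longrightarrow> us ! j = col M (f j)"
    by metis
  \<comment> \<open>Right multiplication by \<open>S\<close> selects the columns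
    \<open>f 0, ..., f (q - 1)\<close>.\<close>
  define S :: "real mat" where "S = mat_of_cols c (map (\<lambda>j. unit_vec c (f j)) [0..<q])"
  have S: "S \<in> carrier_mat c q" by (simp add: S_def carrier_matI)
  have "MV = M * S"
  proof (rule mat_col_eqI)
    fix j assume "j < dim_col (M * S)"
    then have j: "j < q" using S by simp
    have "col (M * S) j = M *\<^sub>v col S j" using M S j by (rule col_mult2)
    also have "col S j = unit_vec c (f j)" using j by (simp add: S_def)
    also have "M *\<^sub>v unit_vec c (f j) = col M (f j)"
      using M f(1)[OF j] by (intro eq_vecI) auto
    finally show "col MV j = col (M * S) j"
      using j f(2) colsMV MV by (metis carrier_matD(2) cols_nth)
  qed (use MV M S in auto)
  then have MV_AT: "MV = A * (B * S)" using A B S by (simp add: M_def)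
  define T where "T = B * S"
  have T: "T \<in> carrier_mat q q" using B S by (simp add: T_def)
  have "det T \<noteq> 0"
  proof
    assume "det T = 0"
    then obtain v where v: "v \<in> carrier_vec q" "v \<noteq> 0\<^sub>v q" "T *\<^sub>v v = 0\<^sub>v q"
      using det_0_iff_vec_prod_zero[OF T] by blast
    have "MV *\<^sub>v v = A *\<^sub>v (T *\<^sub>v v)"
      using MV_AT A T v(1) by (simp add: T_def[symmetric])
    also have "\<dots> = 0\<^sub>v d" using v(3) A by (auto intro!: eq_vecI)
    finally show False using inj v by blast
  qed
  from det_non_zero_imp_unit[OF T this, of "()"]
  obtain Y where Y: "Y \<in> carrier_mat q q" and TY: "T * Y = 1\<^sub>m q"
    unfolding Units_def by (auto simp: ring_mat_simps)
  show ?thesis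
  proof
    show "S * Y \<in> carrier_mat c q" using S Y by simp
    show "B * (S * Y) = 1\<^sub>m q" using TY B S Y by (simp add: T_def)
    fix v assume v: "v \<in> carrier_vec q" "A *\<^sub>v v = 0\<^sub>v d"
    have TYv: "T *\<^sub>v (Y *\<^sub>v v) = v"
      using assoc_mult_mat_vec[OF T Y v(1)] TY v(1) by simp
    have "MV *\<^sub>v (Y *\<^sub>v v) = A *\<^sub>v (T *\<^sub>v (Y *\<^sub>v v))"
      using MV_AT A T Y v(1) by (simp add: T_def[symmetric])
    then have "Y *\<^sub>v v = 0\<^sub>v q" using TYv v Y by (intro inj) auto
    then show "v = 0\<^sub>v q" using TYv T by (auto intro!: eq_vecI)
  qed
qed

text \<open>Fewer homogeneous equations than unknowns: \<open>q\<close> rows of \<open>B\<close>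
  against the \<open>card C\<close> coordinates allowed to be nonzero.\<close>

lemma supported_kernel_vec:
  fixes B :: "real mat"
  assumes B: "B \<in> carrier_mat q d" and C: "C \<subseteq> {..<d}" and qC: "q < card C"
  obtains x where "x \<in> carrier_vec d" "x \<noteq> 0\<^sub>v d" "\<And>i. i < d \<Longrightarrow> i \<notin> C \<Longrightarrow> x $ i = 0"
    and "B *\<^sub>v x = 0\<^sub>v q"
proof -
  have "finite C" using C finite_subset by blast
  then obtain h where h: "bij_betw h C {0..<card C}"
    using ex_bij_betw_finite_nat by blast
  \<comment> \<open>The system is padded to a square one so that determinants apply. Unit rows
    outside \<open>C\<close> force zeros there, the indices of \<open>C\<close> numbered below
    \<open>q\<close> carry the rows of \<open>B\<close>, and the rest give zero rows. Index
    \<open>p\<close>, numbered \<open>q\<close>, supplies a zero row, so \<open>Q\<close> is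
    singular.\<close>
  define Q where "Q = mat d d (\<lambda>(i, j). if i \<notin> C then (if i = j then 1 else 0)
    else if h i < q then B $$ (h i, j) else 0)"
  have Q: "Q \<in> carrier_mat d d" by (simp add: Q_def)
  obtain p where p: "p \<in> C" "h p = q"
    using h qC unfolding bij_betw_def by (metis atLeastLessThan_iff image_iff le0)
  have pd: "p < d" using p C by blast
  have "row Q p = 0\<^sub>v d" using p pd by (intro eq_vecI) (auto simp: Q_def)
  then have "transpose_mat Q *\<^sub>v unit_vec d p = 0\<^sub>v d"
    using pd Q by (intro eq_vecI) (auto simp: row_def vec_eq_iff)
  moreover have "unit_vec d p \<noteq> (0\<^sub>v d :: real vec)"
    using pd by (metis index_unit_vec(2) index_zero_vec(1) zero_neq_one)
  ultimately have "det (transpose_mat Q) = 0"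
    using det_0_iff_vec_prod_zero[of "transpose_mat Q" d] Q
    by (metis transpose_carrier_mat unit_vec_carrier)
  then have "det Q = 0" using det_transpose[OF Q] by simp
  then obtain x where x: "x \<in> carrier_vec d" "x \<noteq> 0\<^sub>v d" "Q *\<^sub>v x = 0\<^sub>v d"
    using det_0_iff_vec_prod_zero[OF Q] by blast
  have row0: "row Q i \<bullet> x = 0" if "i < d" for i
    using x(3) that Q by (metis carrier_matD(1) index_mult_mat_vec index_zero_vec(1))
  show ?thesis
  proof
    show "x \<in> carrier_vec d" "x \<noteq> 0\<^sub>v d" by fact+
    show "x $ i = 0" if i: "i < d" "i \<notin> C" for i
    proof -
      have "row Q i = unit_vec d i"
        using i by (intro eq_vecI) (auto simp: Q_def unit_vec_def)
      then show ?thesis using row0[OF i(1)] x(1) i by simp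
    qed
    show "B *\<^sub>v x = 0\<^sub>v q"
    proof (rule eq_vecI)
      fix j assume "j < dim_vec (0\<^sub>v q)"
      then have j: "j < q" by simp
      then obtain i where i: "i \<in> C" "h i = j"
        using h qC unfolding bij_betw_def
        by (metis atLeastLessThan_iff image_iff le0 order_less_trans)
      have id: "i < d" using i C by blast
      have "row Q i = row B j"
        using i id j B by (intro eq_vecI) (auto simp: Q_def)
      then show "(B *\<^sub>v x) $ j = 0\<^sub>v q $ j" using row0[OF id] j B by simp
    qed (use B in simp)
  qed
qed

text \<open>Columns of \<open>A\<close> and rows of \<open>B\<close> are the indicators of the sides
  of the rectangles, so an entry of \<open>A * B\<close> counts the rectangles containing that
  position. Partition blocks are nonempty, hence no indicator vanishes.\<close>

lemma rectangle_partition_factorization: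
  assumes M: "M \<in> carrier_mat d c" and bin: "binary_mat M"
    and P: "finite P" "rectangle_partition M P"
  obtains A B where "A \<in> carrier_mat d (card P)" "B \<in> carrier_mat (card P) c" "M = A * B"
    "binary_mat A" "binary_mat B"
    and "\<And>j. j < card P \<Longrightarrow> \<exists>i<d. A $$ (i, j) = 1"
    and "\<And>j. j < card P \<Longrightarrow> \<exists>i<c. B $$ (j, i) = 1"
proof -
  let ?q = "card P"
  obtain h where h: "bij_betw h {0..<?q} P"
    using ex_bij_betw_nat_finite[OF P(1)] by blast
  have hP: "h j \<in> P" if "j < ?q" for j using h that by (auto simp: bij_betw_def)
  have part: "partition_on (ones M) P" and rect: "\<And>R. R \<in> P \<Longrightarrow> \<exists>I J. R = I \<times> J"
    using P(2) by (auto simp: rectangle_partition_def)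
  have rectD: "R = fst ` R \<times> snd ` R" if "R \<in> P" for R
    using rect[OF that] by force
  define A :: "real mat" where "A = mat d ?q (\<lambda>(i, j). if i \<in> fst ` h j then 1 else 0)"
  define B :: "real mat" where "B = mat ?q c (\<lambda>(j, i). if i \<in> snd ` h j then 1 else 0)"
  show ?thesis
  proof
    show A: "A \<in> carrier_mat d ?q" and B: "B \<in> carrier_mat ?q c"
      by (simp_all add: A_def B_def)
    show "binary_mat A" "binary_mat B" by (simp_all add: A_def B_def binary_mat_def)
    have ne: "\<exists>i r. i < d \<and> r < c \<and> (i, r) \<in> h j" if "j < ?q" for j
    proof -
      have "h j \<noteq> {}" using part hP[OF that] by (metis partition_onD3)
      moreover have "h j \<subseteq> ones M" using part hP[OF that] by (auto simp: partition_on_def)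
      ultimately show ?thesis using M by (fastforce simp: ones_def)
    qed
    show "\<exists>i<d. A $$ (i, j) = 1" if "j < ?q" for j
      using ne[OF that] that by (force simp: A_def)
    show "\<exists>i<c. B $$ (j, i) = 1" if "j < ?q" for j
      using ne[OF that] that by (force simp: B_def)
    show "M = A * B"
    proof (rule eq_matI)
      fix i r assume "i < dim_row (A * B)" "r < dim_col (A * B)"
      then have ir: "i < d" "r < c" using A B by auto
      have "(A * B) $$ (i, r) = (\<Sum>j = 0..<?q. A $$ (i, j) * B $$ (j, r))"
        using A B ir by (simp add: scalar_prod_def)
      also have "\<dots> = (\<Sum>j = 0..<?q. if (i, r) \<in> h j then 1 else 0)"
      proof (rule sum.cong)
        fix j assume "j \<in> {0..<?q}"
        then have j: "j < ?q" by simp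
        have "(i, r) \<in> h j \<longleftrightarrow> i \<in> fst ` h j \<and> r \<in> snd ` h j"
          using rectD[OF hP[OF j]] by blast
        then show "A $$ (i, j) * B $$ (j, r) = (if (i, r) \<in> h j then 1 else 0)"
          using j ir by (simp add: A_def B_def)
      qed simp
      also have "\<dots> = (\<Sum>R\<in>P. if (i, r) \<in> R then 1 else 0)"
        by (rule sum.reindex_bij_betw[OF h])
      also have "\<dots> = M $$ (i, r)"
      proof (cases "(i, r) \<in> ones M")
        case True
        then obtain R where R: "R \<in> P" "(i, r) \<in> R" using part by (auto simp: partition_on_def)
        have "(i, r) \<in> R' \<longleftrightarrow> R' = R" if "R' \<in> P" for R'
          using R that partition_onD2[OF part] by (auto simp: disjoint_def)
        then have "(\<Sum>R'\<in>P. if (i, r) \<in> R' then 1 else 0) = (\<Sum>R'\<in>P. if R' = R then 1 else (0::real))"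
          by (intro sum.cong) auto
        then show ?thesis using R P(1) True by (simp add: ones_def)
      next
        case False
        then have "(i, r) \<notin> R" if "R \<in> P" for R using part that by (auto simp: partition_on_def)
        then show ?thesis using False ir M bin by (auto simp: ones_def binary_mat_def)
      qed
      finally show "M $$ (i, r) = (A * B) $$ (i, r)" by simp
    qed (use M A B in auto)
  qed
qed

section \<open>Complements\<close>

lemma complement_mat_carrier: "N \<in> carrier_mat d c \<Longrightarrow> complement_mat N \<in> carrier_mat d c"
  by (simp add: complement_mat_def)

lemma complement_mult_vec:
  assumes N: "N \<in> carrier_mat d c" and x: "x \<in> carrier_vec c"
  shows "complement_mat N *\<^sub>v x = (ones_vec c \<bullet> x) \<cdot>\<^sub>v ones_vec d - N *\<^sub>v x"
  using N x by (intro eq_vecI)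
    (auto simp: complement_mat_def scalar_prod_def left_diff_distrib sum_subtractf)

lemma scalar_prod_pos:
  fixes u b :: "real vec"
  assumes "dim_vec u = d" "dim_vec b = d" "\<And>i. i < d \<Longrightarrow> 0 < u $ i"
    and "\<And>i. i < d \<Longrightarrow> b $ i = 0 \<or> b $ i = 1" "\<exists>i<d. b $ i = 1"
  shows "0 < b \<bullet> u"
proof -
  obtain p where p: "p < d" "b $ p = 1" using assms(5) by blast
  have "0 < (\<Sum>i = 0..<d. b $ i * u $ i)"
    by (rule sum_pos2[of _ p]) (use p assms(3,4) in \<open>force simp: less_imp_le\<close>)+
  then show ?thesis using assms by (simp add: scalar_prod_def)
qed

lemma scalar_prod_Ints:
  fixes x y :: "'a::comm_ring_1 vec"
  assumes "\<And>i. i < dim_vec y \<Longrightarrow> x $ i \<in> \<int>" "\<And>i. i < dim_vec y \<Longrightarrow> y $ i \<in> \<int>"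
  shows "x \<bullet> y \<in> \<int>"
  using assms by (auto simp: scalar_prod_def intro!: Ints_sum Ints_mult)

text \<open>The counting argument, free of circulants: \<open>q\<close> rectangles with
  \<open>q\<close> at most the rank would force \<open>q \<le> s < card C\<close>, while
  \<open>indep_cols\<close> leaves no room for such a \<open>q\<close>.\<close>

lemma rank_bin_complement_gt_rank_real:
  assumes N: "N \<in> carrier_mat d d" and bin: "binary_mat N"
    and u: "balancing d N u" and sat: "saturated d N" and C: "indep_cols d N C"
    and s1: "1 < ones_vec d \<bullet> u" and sC: "ones_vec d \<bullet> u < card C"
  shows "rank_bin (complement_mat N) \<ge> rank_real (complement_mat N) + 1"
proof (rule ccontr)
  define M where "M = complement_mat N"
  define s where "s = ones_vec d \<bullet> u"
  assume "\<not> ?thesis"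
  then have low: "rank_bin M \<le> vec_space.rank d M" using N by (simp add: M_def complement_mat_def)
  have M: "M \<in> carrier_mat d d" using N by (simp add: M_def complement_mat_carrier)
  have Mbin: "binary_mat M" using bin by (auto simp: M_def complement_mat_def binary_mat_def)
  have uc: "u \<in> carrier_vec d" and upos: "\<And>i. i < d \<Longrightarrow> 0 < u $ i"
    and Nu: "N *\<^sub>v u = ones_vec d" and uN: "transpose_mat N *\<^sub>v u = ones_vec d"
    using u by (auto simp: balancing_def)
  have sum_eq: "ones_vec d \<bullet> x = u \<bullet> (N *\<^sub>v x)" if "x \<in> carrier_vec d" for x
    using transpose_vec_mult_scalar[OF N that uc] uN by simp
  have s_comm: "u \<bullet> ones_vec d = s" using uc by (simp add: s_def comm_scalar_prod[of u d])
  have Mx: "M *\<^sub>v x = (ones_vec d \<bullet> x) \<cdot>\<^sub>v ones_vec d - N *\<^sub>v x" if "x \<in> carrier_vec d" for x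
    using complement_mult_vec[OF N that] by (simp add: M_def)
  obtain P where P: "finite P" "rectangle_partition M P" "card P = rank_bin M"
    using rank_bin_attained by blast
  define q where "q = card P"
  obtain A B where A: "A \<in> carrier_mat d q" and B: "B \<in> carrier_mat q d" and MAB: "M = A * B"
    and Abin: "binary_mat A" and Bbin: "binary_mat B"
    and Ane: "\<And>j. j < q \<Longrightarrow> \<exists>i<d. A $$ (i, j) = 1"
    and Bne: "\<And>j. j < q \<Longrightarrow> \<exists>i<d. B $$ (j, i) = 1"
    using rectangle_partition_factorization[OF M Mbin P(1,2)] unfolding q_def by metis
  have "q \<le> vec_space.rank d (A * B)" using low P(3) MAB by (simp add: q_def)
  then obtain X where X: "X \<in> carrier_mat d q" "B * X = 1\<^sub>m q"
    and inj: "\<And>v. v \<in> carrier_vec q \<Longrightarrow> A *\<^sub>v v = 0\<^sub>v d \<Longrightarrow> v = 0\<^sub>v q"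
    using full_rank_factorization[OF A B] by blast
  have lower: "s - 1 \<le> (col A j \<bullet> u) * (row B j \<bullet> u)" if j: "j < q" for j
  proof -
    define a where "a = col A j"
    define b where "b = row B j"
    \<comment> \<open>The right inverse of \<open>B\<close> gives
      \<open>B *\<^sub>v x = unit_vec q j\<close>, so \<open>a\<close> is in the column space of
      \<open>M\<close>; adding a multiple of \<open>u\<close> moves this to
      \<open>N\<close>.\<close>
    define x where "x = col X j"
    define c where "c = ones_vec d \<bullet> x"
    define \<alpha> where "\<alpha> = u \<bullet> a"
    have ac: "a \<in> carrier_vec d" and bc: "b \<in> carrier_vec d" and xc: "x \<in> carrier_vec d"
      using A B X by (auto simp: a_def b_def x_def)
    have "B *\<^sub>v x = unit_vec q j"
      using X B j by (metis carrier_matD(2) col_mult2 col_one x_def)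
    moreover have Aej: "A *\<^sub>v unit_vec q j = a"
      using A j by (intro eq_vecI) (auto simp: a_def)
    ultimately have "M *\<^sub>v x = a" using A B xc by (simp add: MAB)
    then have cN: "c \<cdot>\<^sub>v ones_vec d - N *\<^sub>v x = a" using Mx[OF xc] by (simp add: c_def)
    have "N *\<^sub>v (c \<cdot>\<^sub>v u - x) = c \<cdot>\<^sub>v (N *\<^sub>v u) - N *\<^sub>v x"
      using N uc xc by (simp add: mult_minus_distrib_mat_vec[OF N] mult_mat_vec[OF N])
    then have Nx': "N *\<^sub>v (c \<cdot>\<^sub>v u - x) = a" using Nu cN by simp
    have abin: "\<And>i. i < d \<Longrightarrow> a $ i = 0 \<or> a $ i = 1"
      using A j Abin by (auto simp: a_def binary_mat_def)
    have bbin: "\<And>i. i < d \<Longrightarrow> b $ i = 0 \<or> b $ i = 1"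
      using B j Bbin by (auto simp: b_def binary_mat_def)
    have "\<forall>i<d. (N *\<^sub>v (c \<cdot>\<^sub>v u - x)) $ i \<in> \<int>"
      unfolding Nx' using abin by fastforce
    moreover have "c \<cdot>\<^sub>v u - x \<in> carrier_vec d" using uc xc by simp
    ultimately obtain y where y: "y \<in> carrier_vec d" "\<And>i. i < d \<Longrightarrow> y $ i \<in> \<int>" "N *\<^sub>v y = a"
      using sat Nx' unfolding saturated_def by metis
    \<comment> \<open>The coefficient t of \<open>u\<close> solves t s - \<alpha> = t, where
      \<alpha> is the coordinate sum of \<open>y\<close>. Then the all-one parts of
      \<open>M *\<^sub>v z\<close> cancel and \<open>a\<close> remains.\<close>
    define z where "z = (\<alpha> / (s - 1)) \<cdot>\<^sub>v u - y"
    have zc: "z \<in> carrier_vec d" using uc y by (simp add: z_def)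
    have "ones_vec d \<bullet> z = \<alpha> / (s - 1) * s - \<alpha>"
      using uc y by (simp add: z_def s_def \<alpha>_def sum_eq[OF y(1)]
        scalar_prod_minus_distrib[of _ d] scalar_prod_smult_distrib[of _ d])
    also have "\<dots> = \<alpha> / (s - 1)" using s1 by (simp add: s_def[symmetric] field_simps)
    finally have oz: "ones_vec d \<bullet> z = \<alpha> / (s - 1)" .
    have "N *\<^sub>v z = (\<alpha> / (s - 1)) \<cdot>\<^sub>v (N *\<^sub>v u) - a"
      using N uc y by (simp add: z_def mult_minus_distrib_mat_vec[OF N] mult_mat_vec[OF N])
    then have Mz: "M *\<^sub>v z = a" using Mx[OF zc] oz ac Nu by (auto intro!: eq_vecI)
    \<comment> \<open>Both \<open>B *\<^sub>v z\<close> and the unit vector are mapped to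
      \<open>a\<close> by the injective \<open>A\<close>, so they agree; coordinate \<open>j\<close>
      gives \<open>b \<bullet> z = 1\<close>.\<close>
    have "A *\<^sub>v (B *\<^sub>v z - unit_vec q j) = M *\<^sub>v z - a"
      using A B zc Aej by (simp add: MAB mult_minus_distrib_mat_vec[OF A])
    then have "B *\<^sub>v z - unit_vec q j = 0\<^sub>v q"
      using Mz ac B zc by (intro inj) auto
    then have "(B *\<^sub>v z - unit_vec q j) $ j = 0" using j by simp
    then have "b \<bullet> z = 1" using j B by (simp add: b_def)
    then have "\<alpha> / (s - 1) * (b \<bullet> u) - b \<bullet> y = 1"
      using uc y bc by (simp add: z_def scalar_prod_minus_distrib[of _ d] scalar_prod_smult_distrib[of _ d])
    then have key: "\<alpha> * (b \<bullet> u) = (s - 1) * (1 + b \<bullet> y)"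
      using s1 by (simp add: s_def[symmetric] field_simps)
    have "\<exists>i<d. a $ i = 1" using Ane[OF j] A j by (auto simp: a_def)
    then have "0 < a \<bullet> u"
      using scalar_prod_pos[OF carrier_vecD[OF uc] carrier_vecD[OF ac] upos abin] by blast
    moreover have "\<exists>i<d. b $ i = 1" using Bne[OF j] B j by (auto simp: b_def)
    then have "0 < b \<bullet> u"
      using scalar_prod_pos[OF carrier_vecD[OF uc] carrier_vecD[OF bc] upos bbin] by blast
    moreover have \<alpha>: "\<alpha> = a \<bullet> u" using uc ac by (simp add: \<alpha>_def comm_scalar_prod[of u d])
    ultimately have "0 < (s - 1) * (1 + b \<bullet> y)" using key by (metis mult_pos_pos)
    then have "0 < 1 + b \<bullet> y" using s1 by (simp add: s_def[symmetric] zero_less_mult_iff)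
    moreover have "b \<bullet> y \<in> \<int>"
      using y bbin by (intro scalar_prod_Ints) fastforce+
    \<comment> \<open>A positive integer is at least 1; this is where integrality of
      \<open>y\<close> pays off.\<close>
    ultimately have "1 \<le> 1 + b \<bullet> y" by (auto elim!: Ints_cases)
    then have "(s - 1) * 1 \<le> (s - 1) * (1 + b \<bullet> y)"
      using s1 by (intro mult_left_mono) (auto simp: s_def)
    then show ?thesis using key \<alpha> by (simp add: a_def b_def)
  qed
  have "(\<Sum>j = 0..<q. (col A j \<bullet> u) * (row B j \<bullet> u)) = (transpose_mat A *\<^sub>v u) \<bullet> (B *\<^sub>v u)"
    using A B by (simp add: scalar_prod_def[of _ "B *\<^sub>v u"])
  also have "\<dots> = u \<bullet> (M *\<^sub>v u)"
    using transpose_vec_mult_scalar[OF A _ uc, of "B *\<^sub>v u"] A B uc by (simp add: MAB)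
  also have "M *\<^sub>v u = (s - 1) \<cdot>\<^sub>v ones_vec d"
    using Mx[OF uc] Nu by (auto simp: s_def intro!: eq_vecI)
  also have "u \<bullet> ((s - 1) \<cdot>\<^sub>v ones_vec d) = (s - 1) * s"
    using uc s_comm by (simp add: scalar_prod_smult_distrib[of _ d])
  finally have total: "(\<Sum>j = 0..<q. (col A j \<bullet> u) * (row B j \<bullet> u)) = (s - 1) * s" .
  have "(\<Sum>j = 0..<q. s - 1) \<le> (\<Sum>j = 0..<q. (col A j \<bullet> u) * (row B j \<bullet> u))"
    by (intro sum_mono lower) simp
  then have "real q * (s - 1) \<le> (s - 1) * s" using total by simp
  then have "real q \<le> s" using s1 by (simp add: s_def[symmetric] mult.commute)
  then have "q < card C" using sC by (simp add: s_def)
  moreover have "C \<subseteq> {..<d}" using C by (simp add: indep_cols_def)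
  \<comment> \<open>With \<open>q < card C\<close>, some nonzero \<open>x\<close> supported on
    \<open>C\<close> is killed by \<open>B\<close>, hence by \<open>M\<close>. The balancing
    identity turns this into \<open>N *\<^sub>v x = 0\<^sub>v d\<close>, since \<open>s\<close>
    differs from 1.\<close>
  ultimately obtain x where x: "x \<in> carrier_vec d" "x \<noteq> 0\<^sub>v d"
      "\<And>i. i < d \<Longrightarrow> i \<notin> C \<Longrightarrow> x $ i = 0" "B *\<^sub>v x = 0\<^sub>v q"
    using supported_kernel_vec[OF B] by metis
  have "M *\<^sub>v x = A *\<^sub>v (B *\<^sub>v x)" using A B x(1) by (simp add: MAB)
  then have "M *\<^sub>v x = 0\<^sub>v d" using x(4) A by (auto intro!: eq_vecI)
  then have "(ones_vec d \<bullet> x) \<cdot>\<^sub>v ones_vec d - N *\<^sub>v x = 0\<^sub>v d" using Mx[OF x(1)] by simp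
  then have Nx: "N *\<^sub>v x = (ones_vec d \<bullet> x) \<cdot>\<^sub>v ones_vec d"
    using N x(1) by (auto simp: vec_eq_iff)
  have "ones_vec d \<bullet> x = u \<bullet> (N *\<^sub>v x)" by (rule sum_eq[OF x(1)])
  also have "\<dots> = (ones_vec d \<bullet> x) * s"
    unfolding Nx using uc s_comm by (simp add: scalar_prod_smult_distrib[of _ d])
  finally have "ones_vec d \<bullet> x = (ones_vec d \<bullet> x) * s" .
  then have "ones_vec d \<bullet> x = 0" using s1 by (simp add: s_def[symmetric])
  then have "N *\<^sub>v x = 0\<^sub>v d" using Nx by (auto intro!: eq_vecI)
  then show False using C x unfolding indep_cols_def by blast
qed

section \<open>Block sums\<close>

abbreviation block_sum :: "real mat \<Rightarrow> real mat \<Rightarrow> real mat" where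
  "block_sum A B \<equiv> four_block_mat A (0\<^sub>m (dim_row A) (dim_col B)) (0\<^sub>m (dim_row B) (dim_col A)) B"

text \<open>The two halves of a vector do not interact, so each property required of
  \<open>N\<close> can be checked block by block.\<close>

lemma block_sum_mult_vec:
  assumes "A \<in> carrier_mat d d" "B \<in> carrier_mat e e" "x \<in> carrier_vec d" "y \<in> carrier_vec e"
  shows "block_sum A B *\<^sub>v (x @\<^sub>v y) = (A *\<^sub>v x) @\<^sub>v (B *\<^sub>v y)"
  using mult_mat_vec_split[OF assms] assms by auto

lemma carrier_vec_append_cases:
  assumes "x \<in> carrier_vec (d + e)"
  obtains y z where "y \<in> carrier_vec d" "z \<in> carrier_vec e" "x = y @\<^sub>v z"
  using vec_first_last_append[OF assms] by (metis vec_first_carrier vec_last_carrier)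

lemma ones_vec_append: "ones_vec d @\<^sub>v ones_vec e = ones_vec (d + e)"
  by (intro eq_vecI) auto

lemma binary_mat_block_sum: "binary_mat A \<Longrightarrow> binary_mat B \<Longrightarrow> binary_mat (block_sum A B)"
  by (auto simp: binary_mat_def)

lemma balancing_block_sum:
  assumes A: "A \<in> carrier_mat d d" and B: "B \<in> carrier_mat e e"
    and u: "balancing d A u" and v: "balancing e B v"
  shows "balancing (d + e) (block_sum A B) (u @\<^sub>v v)"
proof -
  have uc: "u \<in> carrier_vec d" and vc: "v \<in> carrier_vec e"
    using u v by (auto simp: balancing_def)
  have "transpose_mat (block_sum A B) = block_sum (transpose_mat A) (transpose_mat B)"
    using A B by (subst transpose_four_block_mat) auto
  then show ?thesis
    using u v block_sum_mult_vec[OF A B uc vc]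
      block_sum_mult_vec[of "transpose_mat A" d "transpose_mat B" e, OF _ _ uc vc] A B
    by (auto simp: balancing_def ones_vec_append)
qed

lemma saturated_block_sum:
  assumes A: "A \<in> carrier_mat d d" and B: "B \<in> carrier_mat e e"
    and sA: "saturated d A" and sB: "saturated e B"
  shows "saturated (d + e) (block_sum A B)"
  unfolding saturated_def
proof (intro ballI impI)
  fix x assume "x \<in> carrier_vec (d + e)"
    and int: "\<forall>i<d + e. (block_sum A B *\<^sub>v x) $ i \<in> \<int>"
  then obtain y z where y: "y \<in> carrier_vec d" and z: "z \<in> carrier_vec e" and x: "x = y @\<^sub>v z"
    by (metis carrier_vec_append_cases)
  have eq: "block_sum A B *\<^sub>v x = (A *\<^sub>v y) @\<^sub>v (B *\<^sub>v z)"
    using block_sum_mult_vec[OF A B y z] by (simp add: x)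
  have "(A *\<^sub>v y) $ i \<in> \<int>" if "i < d" for i
    using int[rule_format, of i] that A B unfolding eq by (simp del: index_mult_mat_vec)
  then obtain y' where y': "y' \<in> carrier_vec d" "\<forall>i<d. y' $ i \<in> \<int>" "A *\<^sub>v y' = A *\<^sub>v y"
    using sA y unfolding saturated_def by metis
  have "(B *\<^sub>v z) $ i \<in> \<int>" if "i < e" for i
    using int[rule_format, of "d + i"] that A B unfolding eq by (simp del: index_mult_mat_vec)
  then obtain z' where z': "z' \<in> carrier_vec e" "\<forall>i<e. z' $ i \<in> \<int>" "B *\<^sub>v z' = B *\<^sub>v z"
    using sB z unfolding saturated_def by metis
  show "\<exists>y\<in>carrier_vec (d + e). (\<forall>i<d + e. y $ i \<in> \<int>) \<and> block_sum A B *\<^sub>v y = block_sum A B *\<^sub>v x"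
  proof (intro bexI conjI)
    show "block_sum A B *\<^sub>v (y' @\<^sub>v z') = block_sum A B *\<^sub>v x"
      using block_sum_mult_vec[OF A B y'(1) z'(1)] y'(3) z'(3) eq by simp
  qed (use y' z' in auto)
qed

lemma indep_cols_block_sum:
  assumes A: "A \<in> carrier_mat d d" and B: "B \<in> carrier_mat e e"
    and C: "indep_cols d A C" and D: "indep_cols e B D"
  shows "indep_cols (d + e) (block_sum A B) (C \<union> (+) d ` D)"
  unfolding indep_cols_def
proof (intro ballI impI conjI)
  show "C \<union> (+) d ` D \<subseteq> {..<d + e}" using C D by (auto simp: indep_cols_def)
next
  fix x assume "x \<in> carrier_vec (d + e)"
    and supp: "\<forall>i<d + e. i \<notin> C \<union> (+) d ` D \<longrightarrow> x $ i = 0"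
    and ker: "block_sum A B *\<^sub>v x = 0\<^sub>v (d + e)"
  then obtain y z where y: "y \<in> carrier_vec d" and z: "z \<in> carrier_vec e" and x: "x = y @\<^sub>v z"
    by (metis carrier_vec_append_cases)
  have zero: "0\<^sub>v d @\<^sub>v 0\<^sub>v e = (0\<^sub>v (d + e) :: real vec)" by (intro eq_vecI) auto
  have "(A *\<^sub>v y) @\<^sub>v (B *\<^sub>v z) = 0\<^sub>v d @\<^sub>v 0\<^sub>v e"
    using block_sum_mult_vec[OF A B y z] ker by (simp add: x zero)
  then have "A *\<^sub>v y = 0\<^sub>v d" "B *\<^sub>v z = 0\<^sub>v e"
    using A y append_vec_eq[of "A *\<^sub>v y" d "0\<^sub>v d"] by auto
  moreover have "\<forall>i<d. i \<notin> C \<longrightarrow> y $ i = 0"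
  proof (intro allI impI)
    fix i assume i: "i < d" "i \<notin> C"
    then have "i \<notin> C \<union> (+) d ` D" by auto
    then show "y $ i = 0" using supp[rule_format, of i] i y z by (simp add: x)
  qed
  moreover have "\<forall>i<e. i \<notin> D \<longrightarrow> z $ i = 0"
  proof (intro allI impI)
    fix i assume i: "i < e" "i \<notin> D"
    have "d + i \<notin> C \<union> (+) d ` D" using i C by (auto simp: indep_cols_def)
    then show "z $ i = 0" using supp[rule_format, of "d + i"] i y z by (simp add: x)
  qed
  ultimately have "y = 0\<^sub>v d" "z = 0\<^sub>v e"
    using C D y z by (auto simp: indep_cols_def)
  then show "x = 0\<^sub>v (d + e)" using zero by (simp add: x)
qed

section \<open>A single circulant block\<close>

text \<open>Sliding the window one step drops \<open>h i\<close> and gains the equal value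
  \<open>h (i + k)\<close>.\<close>

lemma periodic_window_sum:
  fixes h :: "nat \<Rightarrow> 'a::ab_group_add"
  assumes "\<And>i. h (i + k) = h i"
  shows "(\<Sum>l<k. h (i + l)) = (\<Sum>l<k. h l)"
proof (induction i)
  case (Suc i)
  have "(\<Sum>l<k. h (Suc i + l)) + h i = (\<Sum>l<Suc k. h (i + l))"
    unfolding sum.lessThan_Suc_shift by simp
  also have "\<dots> = (\<Sum>l<k. h (i + l)) + h i" by (simp add: assms)
  finally show ?case using Suc by simp
qed simp

locale circulant_block =
  fixes n k :: nat
  assumes k_pos: "0 < k" and k_le: "k \<le> n" and k_dvd: "k dvd n"
begin

abbreviation D :: "real mat" where "D \<equiv> D_mat n (n - k)"

lemma D_carrier: "D \<in> carrier_mat n n"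
  by (simp add: D_mat_def circulant_mat_def)

lemma D_index: "i < n \<Longrightarrow> j < n \<Longrightarrow> D $$ (i, j) = (if (j + n - i) mod n < k then 1 else 0)"
  using k_le by (auto simp: D_mat_def circulant_mat_def)

lemma binary_D: "binary_mat D"
  using D_carrier by (auto simp: binary_mat_def D_index)

text \<open>Row \<open>i\<close> of \<open>D\<close> has its ones on the cyclic window of length
  \<open>k\<close> starting at \<open>i\<close>, so \<open>D\<close> takes cyclic window sums. The
  sum is reindexed by the offset from \<open>i\<close>.\<close>

lemma D_mult_index:
  assumes x: "x \<in> carrier_vec n" and i: "i < n"
  shows "(D *\<^sub>v x) $ i = (\<Sum>l<k. x $ ((i + l) mod n))"
proof -
  have "(D *\<^sub>v x) $ i = (\<Sum>j = 0..<n. (if (j + n - i) mod n < k then 1 else 0) * x $ j)"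
    using x i D_carrier by (simp add: scalar_prod_def D_index)
  also have "\<dots> = (\<Sum>j | j < n \<and> (j + n - i) mod n < k. x $ j)"
    by (intro sum.mono_neutral_cong_right) auto
  also have "\<dots> = (\<Sum>l<k. x $ ((i + l) mod n))"
  proof (rule sum.reindex_bij_witness[of _ "\<lambda>l. (i + l) mod n" "\<lambda>j. (j + n - i) mod n"])
    fix j assume j: "j \<in> {j. j < n \<and> (j + n - i) mod n < k}"
    have "(i + (j + n - i) mod n) mod n = (i + (j + n - i)) mod n" by (simp add: mod_add_right_eq)
    also have "i + (j + n - i) = j + n" using i by simp
    finally show *: "(i + (j + n - i) mod n) mod n = j" using j by simp
    show "x $ ((i + (j + n - i) mod n) mod n) = x $ j" using * by simp
  next
    fix l assume l: "l \<in> {..<k}"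
    have "((i + l) mod n + n - i) mod n = ((i + l) mod n + (n - i)) mod n" using i by simp
    also have "\<dots> = (i + l + (n - i)) mod n" by (simp add: mod_add_left_eq)
    also have "i + l + (n - i) = l + n" using i by simp
    finally show "((i + l) mod n + n - i) mod n = l" using l k_le by simp
    then show "(i + l) mod n \<in> {j. j < n \<and> (j + n - i) mod n < k}" using i l by simp
  qed auto
  finally show ?thesis .
qed

lemma D_col_sum:
  assumes j: "j < n"
  shows "(\<Sum>i = 0..<n. D $$ (i, j)) = k"
proof -
  have "(\<Sum>i = 0..<n. D $$ (i, j)) = (\<Sum>i = 0..<n. if (j + n - i) mod n < k then 1 else 0)"
    using j by (intro sum.cong) (auto simp: D_index)
  also have "\<dots> = (\<Sum>i | i < n \<and> (j + n - i) mod n < k. 1)"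
    by (intro sum.mono_neutral_cong_right) auto
  also have "\<dots> = (\<Sum>l<k. 1)"
  proof (rule sum.reindex_bij_witness[of _ "\<lambda>l. (j + n - l) mod n" "\<lambda>i. (j + n - i) mod n"])
    \<comment> \<open>For fixed \<open>j\<close>, the map sending \<open>i\<close> to
      \<open>j - i\<close> modulo \<open>n\<close> is an involution; the cases are wraparound or
      not.\<close>
    have inv: "(j + n - (j + n - i) mod n) mod n = i" if "i < n" for i
    proof (cases "i \<le> j")
      case True
      then have e: "j + n - i = (j - i) + n" and f: "j + n - (j - i) = i + n" by simp_all
      have g: "(j - i + n) mod n = j - i" using j by simp
      show ?thesis unfolding e g f using that by simp
    next
      case False
      then have "j + n - i < n" using that by linarith
      then have e: "(j + n - i) mod n = j + n - i" by (rule mod_less)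
      have f: "j + n - (j + n - i) = i" using that by linarith
      show ?thesis unfolding e f using that by simp
    qed
    then show "(j + n - (j + n - i) mod n) mod n = i"
      if "i \<in> {i. i < n \<and> (j + n - i) mod n < k}" for i using that by simp
    show "(j + n - (j + n - l) mod n) mod n = l" if "l \<in> {..<k}" for l
      using that k_le by (simp add: inv)
    then show "(j + n - l) mod n \<in> {i. i < n \<and> (j + n - i) mod n < k}" if "l \<in> {..<k}" for l
      using that j by simp
  qed auto
  finally show ?thesis by simp
qed

definition u :: "real vec" where "u = vec n (\<lambda>_. 1 / k)"

lemma balancing_D: "balancing n D u"
  unfolding balancing_def
proof (intro conjI allI impI)
  show "D *\<^sub>v u = ones_vec n"
  proof (rule eq_vecI)
    fix i assume "i < dim_vec (ones_vec n)"
    then have "(D *\<^sub>v u) $ i = (\<Sum>l<k. u $ ((i + l) mod n))" and "i < n"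
      by (simp_all add: D_mult_index u_def del: index_mult_mat_vec)
    then show "(D *\<^sub>v u) $ i = ones_vec n $ i"
      using k_pos by (simp add: u_def del: index_mult_mat_vec)
  qed (use D_carrier in simp)
  show "transpose_mat D *\<^sub>v u = ones_vec n"
  proof (rule eq_vecI)
    fix j assume "j < dim_vec (ones_vec n)"
    then have j: "j < n" by simp
    have "(transpose_mat D *\<^sub>v u) $ j = (\<Sum>i = 0..<n. D $$ (i, j)) / k"
      using D_carrier j by (simp add: scalar_prod_def u_def sum_divide_distrib)
    then show "(transpose_mat D *\<^sub>v u) $ j = ones_vec n $ j"
      using D_col_sum[OF j] k_pos j by simp
  qed (use D_carrier in simp)
qed (use k_pos in \<open>auto simp: u_def\<close>)

lemma ones_u: "ones_vec n \<bullet> u = real n / real k"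
  by (simp add: scalar_prod_def u_def)

text \<open>If all window sums of \<open>x\<close> are integers then \<open>frac \<circ> x\<close> is \<open>k\<close>-periodic, since
  \<open>x (i + k) - x i\<close> is a difference of window sums. Hence \<open>x\<close> becomes integral after subtracting a
  \<open>k\<close>-periodic function with zero window sums.\<close>

lemma saturated_D: "saturated n D"
  unfolding saturated_def
proof (intro ballI impI)
  fix x assume x: "x \<in> carrier_vec n" and int: "\<forall>i<n. (D *\<^sub>v x) $ i \<in> \<int>"
  define X where "X i = x $ (i mod n)" for i
  have n_pos: "0 < n" using k_pos k_le by simp
  have W: "(\<Sum>l<k. X (i + l)) \<in> \<int>" for i
  proof -
    have "(\<Sum>l<k. X (i + l)) = (D *\<^sub>v x) $ (i mod n)"
      using n_pos x by (simp add: D_mult_index X_def mod_add_left_eq del: index_mult_mat_vec)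
    then show ?thesis using int n_pos by simp
  qed
  have shift: "frac (X (i + k)) = frac (X i)" for i
  proof -
    have "(\<Sum>l<k. X (Suc i + l)) + X i = (\<Sum>l<Suc k. X (i + l))"
      unfolding sum.lessThan_Suc_shift by simp
    then have "X (i + k) = X i + ((\<Sum>l<k. X (Suc i + l)) - (\<Sum>l<k. X (i + l)))" by simp
    moreover have "(\<Sum>l<k. X (Suc i + l)) - (\<Sum>l<k. X (i + l)) \<in> \<int>" using W by (intro Ints_diff)
    ultimately show ?thesis by (metis frac_add_int_right frac_unique_iff)
  qed
  define F where "F = (\<Sum>l<k. frac (X l))"
  \<comment> \<open>Every window of length \<open>k\<close> contains exactly one multiple of
    \<open>k\<close>; subtracting \<open>F\<close> there cancels the total of the fractional
    parts.\<close>
  define g where "g i = frac (X i) - (if k dvd i then F else 0)" for i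
  have g_per: "g (i + k) = g i" for i by (simp add: g_def shift)
  have "(\<Sum>l<k. if k dvd l then F else 0) = (\<Sum>l<k. if l = 0 then F else 0)"
    by (intro sum.cong) (auto dest: dvd_imp_le)
  then have "(\<Sum>l<k. g l) = 0" using k_pos by (simp add: g_def sum_subtractf F_def)
  then have g_sum: "(\<Sum>l<k. g (i + l)) = 0" for i using periodic_window_sum[of g k, OF g_per] by simp
  \<comment> \<open>Since \<open>k\<close> divides \<open>n\<close>, reduction modulo
    \<open>n\<close> preserves being a multiple of \<open>k\<close>, so \<open>g\<close> is well
    defined on the cycle.\<close>
  have g_mod: "g (i mod n) = g i" for i
    using k_dvd by (simp add: g_def X_def dvd_mod_iff)
  \<comment> \<open>\<open>F\<close> is a window sum of \<open>x\<close> minus integer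
    floors.\<close>
  have "F = (\<Sum>l<k. X (0 + l)) - (\<Sum>l<k. of_int \<lfloor>X l\<rfloor>)"
    by (simp add: F_def frac_def sum_subtractf)
  then have F_int: "F \<in> \<int>" using W[of 0] by (metis Ints_diff Ints_of_int Ints_sum)
  define y where "y = vec n (\<lambda>i. x $ i - g i)"
  show "\<exists>y\<in>carrier_vec n. (\<forall>i<n. y $ i \<in> \<int>) \<and> D *\<^sub>v y = D *\<^sub>v x"
  proof (intro bexI conjI allI impI)
    show yc: "y \<in> carrier_vec n" by (simp add: y_def)
    show "y $ i \<in> \<int>" if "i < n" for i
    proof -
      have "y $ i = of_int \<lfloor>x $ i\<rfloor> + (if k dvd i then F else 0)"
        using that by (simp add: y_def g_def X_def frac_def)
      then show ?thesis using F_int by simp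
    qed
    show "D *\<^sub>v y = D *\<^sub>v x"
    proof (rule eq_vecI)
      fix i assume "i < dim_vec (D *\<^sub>v x)"
      then have i: "i < n" using D_carrier by simp
      have "(D *\<^sub>v y) $ i = (\<Sum>l<k. X (i + l) - g (i + l))"
        using n_pos yc i by (simp add: D_mult_index y_def X_def g_mod del: index_mult_mat_vec)
      also have "\<dots> = (D *\<^sub>v x) $ i"
        using x i by (simp add: sum_subtractf g_sum D_mult_index X_def del: index_mult_mat_vec)
      finally show "(D *\<^sub>v y) $ i = (D *\<^sub>v x) $ i" .
    qed simp
  qed
qed

text \<open>The columns at multiples of \<open>k\<close> have supports that tile the rows. Column 1
  is a further independent one, except when \<open>k = 1\<close>, where all columns are already
  taken, or \<open>k = n\<close>, where all columns coincide.\<close>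

definition C :: "nat set" where
  "C = (\<lambda>l. l * k) ` {..<n div k} \<union> (if 1 < k \<and> k < n then {1} else {})"

lemma card_C: "card C = n div k + (if 1 < k \<and> k < n then 1 else 0)"
proof -
  have "card ((\<lambda>l. l * k) ` {..<n div k}) = n div k"
    using k_pos by (subst card_image) (auto simp: inj_on_def)
  moreover have "1 \<notin> (\<lambda>l. l * k) ` {..<n div k}" if "1 < k"
  proof
    assume "1 \<in> (\<lambda>l. l * k) ` {..<n div k}"
    then have "k dvd 1" by (metis dvd_triv_right imageE)
    then show False using that by simp
  qed
  ultimately show ?thesis by (simp add: C_def)
qed

text \<open>In the presence of column 1, a triangular elimination: the window at a positive multiple
  of \<open>k\<close> meets \<open>C\<close> only at its start, so \<open>x\<close> vanishes there.
  The window at 1 then isolates \<open>x $ 1\<close>, and the window at 0 isolates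
  \<open>x $ 0\<close>. Otherwise every window at a multiple of \<open>k\<close> meets
  \<open>C\<close> only at its start.\<close>

lemma indep_cols_D: "indep_cols n D C"
  unfolding indep_cols_def
proof (intro conjI ballI impI)
  have mult_less: "l * k < n" if "l < n div k" for l
    using that k_dvd k_pos by (metis dvd_div_mult_self mult_less_mono1)
  then show "C \<subseteq> {..<n}" by (auto simp: C_def)
  fix x assume x: "x \<in> carrier_vec n" and supp: "\<forall>i<n. i \<notin> C \<longrightarrow> x $ i = 0"
    and ker: "D *\<^sub>v x = 0\<^sub>v n"
  have W: "(\<Sum>l<k. x $ ((i + l) mod n)) = 0" if "i < n" for i
    using D_mult_index[OF x that] ker that by simp
  have nz: "k dvd i \<or> (1 < k \<and> k < n \<and> i = 1)" if "i < n" "x $ i \<noteq> 0" for i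
    using supp that unfolding C_def by (auto split: if_splits)
  have window: "x $ (j * k) = 0" if "j < n div k" "0 < j \<or> \<not> (1 < k \<and> k < n)" for j
  proof -
    have "x $ ((j * k + l) mod n) = 0" if "l \<in> {..<k} - {0}" for l
    proof -
      have l: "0 < l" "l < k" using that by auto
      have "j * k + k \<le> n"
        using \<open>j < n div k\<close> k_dvd
        by (metis Suc_leI add.commute dvd_div_mult_self mult_Suc mult_le_mono1)
      then have less: "j * k + l < n" using l by simp
      have "\<not> k dvd j * k + l" using l by (simp add: dvd_add_right_iff nat_dvd_not_less)
      \<comment> \<open>Index 1 lies in the window at 0 only, which is excluded when column 1
        belongs to \<open>C\<close>.\<close>
      moreover have "j * k + l \<noteq> 1 \<or> \<not> (1 < k \<and> k < n)" using \<open>0 < j \<or> _\<close> l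
        by (cases j) auto
      ultimately show ?thesis using nz[OF less] less by auto
    qed
    then have "(\<Sum>l<k. x $ ((j * k + l) mod n)) = x $ ((j * k + 0) mod n)"
      using k_pos by (subst sum.remove[of _ 0]) auto
    then show ?thesis using W[OF mult_less[OF that(1)]] mult_less[OF that(1)] by simp
  qed
  have quot_less: "i div k < n div k" if "k dvd i" "i < n" for i
    using that(2) k_pos dvd_imp_mod_0[OF that(1)] dvd_imp_mod_0[OF k_dvd] by (rule div_less_mono)
  have "x $ i = 0" if "i < n" for i
  proof (cases "1 < k \<and> k < n")
    case False
    then show ?thesis using nz[OF that] window[OF quot_less] that
      by (metis dvd_div_mult_self)
  next
    case True
    have pos: "x $ i = 0" if "k dvd i" "0 < i" "i < n" for i
    proof -
      have "0 < i div k" using dvd_imp_le[OF that(1,2)] k_pos by (simp add: div_greater_zero_iff)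
      then show ?thesis using window[OF quot_less[OF that(1,3)]] that(1) by simp
    qed
    have x1: "x $ 1 = 0"
    proof -
      have "x $ ((1 + l) mod n) = 0" if "l \<in> {..<k} - {0}" for l
      proof -
        have l: "0 < l" "1 + l \<le> k" using that by auto
        then have less: "1 + l < n" using True by simp
        \<comment> \<open>The window at 1 ends at \<open>k\<close>, a positive multiple of
          \<open>k\<close> below \<open>n\<close>, where \<open>pos\<close> applies.\<close>
        show ?thesis using nz[OF less] pos[of "1 + l"] less l by auto
      qed
      then have "(\<Sum>l<k. x $ ((1 + l) mod n)) = x $ ((1 + 0) mod n)"
        using k_pos by (subst sum.remove[of _ 0]) auto
      then show ?thesis using W[of 1] True by simp
    qed
    have x0: "x $ 0 = 0"
    proof -
      have "x $ ((0 + l) mod n) = 0" if "l \<in> {..<k} - {0}" for l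
      proof -
        have l: "0 < l" "l < k" using that by auto
        then have less: "l < n" using True by simp
        show ?thesis using nz[OF less] pos[of l] x1 less l by auto
      qed
      then have "(\<Sum>l<k. x $ ((0 + l) mod n)) = x $ ((0 + 0) mod n)"
        using k_pos by (subst sum.remove[of _ 0]) auto
      then show ?thesis using W[of 0] True by simp
    qed
    show ?thesis using nz[OF that] pos x0 x1 that by (cases "i = 0") auto
  qed
  then show "x = 0\<^sub>v n" using x by (intro eq_vecI) auto
qed

end

section \<open>Circulant block diagonal matrices\<close>

text \<open>Induction over the blocks, concatenating the weights and shifting the column sets.
  \<open>card C\<close> exceeds the total weight by the number of blocks with
  \<open>1 < k i < n i\<close>.\<close>

lemma circulant_diag_block_properties:
  assumes "\<And>i. i \<in> set js \<Longrightarrow> circulant_block (n i) (k i)"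
  defines "N \<equiv> diag_block_mat (map (\<lambda>i. D_mat (n i) (n i - k i)) js)"
  shows "\<exists>d u C. N \<in> carrier_mat d d \<and> binary_mat N \<and> balancing d N u \<and> saturated d N \<and>
    indep_cols d N C \<and> ones_vec d \<bullet> u = real (\<Sum>i\<leftarrow>js. n i div k i) \<and>
    card C = (\<Sum>i\<leftarrow>js. n i div k i + (if 1 < k i \<and> k i < n i then 1 else 0))"
  using assms(1) unfolding N_def
proof (induction js)
  case Nil
  show ?case
    by (intro exI[of _ 0] exI[of _ "0\<^sub>v 0"] exI[of _ "{}"])
      (auto simp: binary_mat_def balancing_def saturated_def indep_cols_def scalar_prod_def
        intro!: eq_vecI)
next
  case (Cons i js)
  let ?N = "diag_block_mat (map (\<lambda>i. D_mat (n i) (n i - k i)) js)"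
  have "circulant_block (n j) (k j)" if "j \<in> set js" for j using Cons.prems that by simp
  from Cons.IH[OF this] obtain d v C' where IH: "?N \<in> carrier_mat d d" "binary_mat ?N" "balancing d ?N v"
      "saturated d ?N" "indep_cols d ?N C'" "ones_vec d \<bullet> v = real (\<Sum>i\<leftarrow>js. n i div k i)"
      "card C' = (\<Sum>i\<leftarrow>js. n i div k i + (if 1 < k i \<and> k i < n i then 1 else 0))"
    by blast
  interpret circulant_block "n i" "k i" using Cons.prems by simp
  have u: "u \<in> carrier_vec (n i)" and v: "v \<in> carrier_vec d"
    using balancing_D IH(3) by (simp_all add: balancing_def)
  have "ones_vec (n i + d) \<bullet> (u @\<^sub>v v) = real (\<Sum>i\<leftarrow>i # js. n i div k i)"
    using scalar_prod_append[OF _ _ u v, of "ones_vec (n i)" "ones_vec d"] ones_u IH(6) k_dvd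
    by (simp add: ones_vec_append real_of_nat_div)
  moreover have "card (C \<union> (+) (n i) ` C') = card C + card C'"
  proof -
    have sub: "C \<subseteq> {..<n i}" "C' \<subseteq> {..<d}" using indep_cols_D IH(5) by (auto simp: indep_cols_def)
    then have "finite C" "finite C'" by (auto intro: finite_subset)
    moreover have "C \<inter> (+) (n i) ` C' = {}" using sub by auto
    ultimately show ?thesis by (simp add: card_Un_disjoint card_image)
  qed
  ultimately show ?case
    using binary_mat_block_sum[OF binary_D IH(2)]
      balancing_block_sum[OF D_carrier IH(1) balancing_D IH(3)]
      saturated_block_sum[OF D_carrier IH(1) saturated_D IH(4)]
      indep_cols_block_sum[OF D_carrier IH(1) indep_cols_D IH(5)] card_C IH(1,7) D_carrier
    by (intro exI[of _ "n i + d"] exI[of _ "u @\<^sub>v v"] exI[of _ "C \<union> (+) (n i) ` C'"])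
      (simp add: Let_def)
qed

theorem theorem1p4:
  fixes m :: nat and k n :: "nat \<Rightarrow> nat" and M :: "real mat"
  assumes "m \<ge> 1"
    and "\<And>i. i \<in> {1..m} \<Longrightarrow> n i \<ge> k i \<and> k i > 0"
    and "M = complement_mat (circulant_block_diag m k n)"
    and "\<And>i. i \<in> {1..m} \<Longrightarrow> k i dvd n i"
    and "\<exists>i\<in>{1..m}. n i > k i \<and> k i > 1"
  shows "rank_bin M \<ge> rank_real M + 1"
proof -
  let ?N = "circulant_block_diag m k n" and ?js = "[1..<m + 1]"
  obtain p where p: "p \<in> {1..m}" "k p < n p" "1 < k p" using assms(5) by blast
  have set_js: "set ?js = {1..m}" by auto
  have "circulant_block (n i) (k i)" if "i \<in> set ?js" for i
    using that assms(2,4) unfolding set_js by (simp add: circulant_block_def)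
  from circulant_diag_block_properties[of ?js n k, OF this]
  obtain d u C where N: "?N \<in> carrier_mat d d" "binary_mat ?N" "balancing d ?N u"
      "saturated d ?N" "indep_cols d ?N C"
    and s: "ones_vec d \<bullet> u = real (\<Sum>i\<leftarrow>?js. n i div k i)"
    and C: "card C = (\<Sum>i\<leftarrow>?js. n i div k i + (if 1 < k i \<and> k i < n i then 1 else 0))"
    unfolding circulant_block_diag_def by blast
  have to_sum: "(\<Sum>i\<leftarrow>?js. f i) = (\<Sum>i\<in>{1..m}. f i)" for f :: "nat \<Rightarrow> nat"
    using sum_list_distinct_conv_sum_set[of ?js f] set_js by simp
  \<comment> \<open>A proper multiple of \<open>k p\<close> is at least twice \<open>k p\<close>, so
    block \<open>p\<close> alone makes the total weight exceed 1; its extra column later gives the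
    strict inequality.\<close>
  have "1 < n p div k p" using p assms(4)[OF p(1)] by (auto elim!: dvdE)
  also have "\<dots> \<le> (\<Sum>i\<in>{1..m}. n i div k i)" using p by (intro member_le_sum) auto
  finally have s1: "1 < (\<Sum>i\<in>{1..m}. n i div k i)" .
  have "(\<Sum>i\<in>{1..m}. n i div k i) <
      (\<Sum>i\<in>{1..m}. n i div k i + (if 1 < k i \<and> k i < n i then 1 else 0))"
    using p by (intro sum_strict_mono_ex1) auto
  then have "ones_vec d \<bullet> u < card C" unfolding s C to_sum by (simp only: of_nat_less_iff)
  moreover have "1 < ones_vec d \<bullet> u" using s1 unfolding s to_sum by (simp del: of_nat_sum)
  ultimately show ?thesis
    unfolding assms(3) by (intro rank_bin_complement_gt_rank_real[OF N])
qed

end
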